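(* Let $\mathcal{C}$ be a crystal framework in $\mathbb{R}^2$ with periodicity basis $\underline{a}=\{a_1,a_2\}$, and let $H$ be a line through the origin in $\mathbb{R}^2$ that is rational for $\mathcal{C}$, with reciprocal line $H^{\underline{a}}$ in $\mathbb{R}^2_{\bf k}$. If the zero mode spectrum ${\bf K}(\mathcal{C},\underline{a})$ contains a line parallel to $H^{\underline{a}}$, then $\mathcal{C}$ has a nonzero $H$-localised phase-periodic infinitesimal flex.
   Context: A bar-joint framework $(G,p)$ in $\mathbb{R}^d$ is a countable simple graph $G=(V,E)$ with a placement $p:V\to\mathbb{R}^d$ of distinct points; the points $p(v)$ are the joints and the pairs $p(v),p(w)$ with $vw\in E$ give the bars. It is a crystal framework with periodicity basis $\underline{a}=\{a_1,\dots,a_d\}$ (a basis of $\mathbb{R}^d$) if it is invariant under translation by each $a_i$ (as a set of joints and bars) and there are finitely many translation orbits of joints and of bars for the lattice generated by $\underline{a}$. A velocity field is a map $u:p(V)\to\mathbb{C}^d$. It is an infinitesimal flex if $\langle u(p(v))-u(p(w)),p(v)-p(w)\rangle=0$ for all $vw\in E$. For $k\in\mathbb{Z}^d$ put $T_k(x)=x+k_1a_1+\dots+k_da_d$. The zero mode spectrum ${\bf K}(\mathcal{C},\underline{a})$ is the set of $(\gamma_1,\dots,\gamma_d)\in\mathbb{R}^d$ for which there is a nonzero infinitesimal flex $u$ with $u(T_k(p_j))=e^{2\pi i(k_1\gamma_1+\dots+k_d\gamma_d)}u(p_j)$ for all joints $p_j$ and all $k\in\mathbb{Z}^d$. It is regarded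 as a subset of the reciprocal space $\mathbb{R}^d_{\bf k}$, a copy of $\mathbb{R}^d$ with its standard basis. A line $H$ through the origin in $\mathbb{R}^2$ is rational for $\mathcal{C}$ if $H=\mathbb{R}(j_1a_1+j_2a_2)$ for some integers $j_1,j_2$ (not both $0$). If $H=\mathbb{R}(\alpha_1a_1+\beta_1a_2)$ then the reciprocal line is $H^{\underline{a}}=\mathbb{R}(\beta_1,-\alpha_1)\subset\mathbb{R}^2_{\bf k}$. A velocity field is $H$-localised if there is an upper bound to the distances from $H$ of the joints in its support. For a rational line $H$, an $H$-localised velocity field $u$ is phase-periodic if there are integers $j_1,j_2$ with $h=j_1a_1+j_2a_2\neq 0$, $H=\mathbb{R}h$, and a unimodular $\lambda\in\mathbb{C}$ with $u(p_j+h)=\lambda u(p_j)$ for all joints $p_j$. *)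

theory Defs
  imports "HOL-Analysis.Analysis"
begin

definition simple_graph :: "'v set \<Rightarrow> 'v set set \<Rightarrow> bool" where
  "simple_graph V E \<longleftrightarrow> (\<forall>e\<in>E. \<exists>v\<in>V. \<exists>w\<in>V. v \<noteq> w \<and> e = {v, w})"

definition bar_joint_framework ::
    "'v set \<Rightarrow> 'v set set \<Rightarrow> ('v \<Rightarrow> real^'n) \<Rightarrow> bool" where
  "bar_joint_framework V E p \<longleftrightarrow> countable V \<and> simple_graph V E \<and> inj_on p V"

definition joints :: "'v set \<Rightarrow> ('v \<Rightarrow> real^'n) \<Rightarrow> (real^'n) set" where
  "joints V p = p ` V"

definition bars :: "'v set set \<Rightarrow> ('v \<Rightarrow> real^'n) \<Rightarrow> (real^'n) set set" where
  "bars E p = (\<lambda>e. p ` e) ` E"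

definition is_basis :: "('n \<Rightarrow> real^'n) \<Rightarrow> bool" where
  "is_basis a \<longleftrightarrow> inj a \<and> independent (range a) \<and> span (range a) = UNIV"

definition transl :: "('n \<Rightarrow> real^'n) \<Rightarrow> int^'n \<Rightarrow> real^'n \<Rightarrow> real^'n" where
  "transl a k x = x + (\<Sum>i\<in>UNIV. of_int (k $ i) *\<^sub>R a i)"

definition crystal_framework ::
    "'v set \<Rightarrow> 'v set set \<Rightarrow> ('v \<Rightarrow> real^'n) \<Rightarrow> ('n \<Rightarrow> real^'n) \<Rightarrow> bool" where
  "crystal_framework V E p a \<longleftrightarrow>
     bar_joint_framework V E p \<and> is_basis a \<and>
     (\<forall>i. (\<lambda>x. x + a i) ` joints V p = joints V p) \<and>
     (\<forall>i. (\<lambda>b. (\<lambda>x. x + a i) ` b) ` bars E p = bars E p) \<and>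
     finite ((\<lambda>x. {transl a k x |k. True}) ` joints V p) \<and>
     finite ((\<lambda>b. {transl a k ` b |k. True}) ` bars E p)"

text \<open>
  A velocity field is represented by a total function on space; only its values at the
  joints are ever used, so \<open>nonzero_field\<close> and \<open>localised\<close> refer to joints only.
\<close>

definition nonzero_field ::
    "'v set \<Rightarrow> ('v \<Rightarrow> real^'n) \<Rightarrow> (real^'n \<Rightarrow> complex^'n) \<Rightarrow> bool" where
  "nonzero_field V p u \<longleftrightarrow> (\<exists>x\<in>joints V p. u x \<noteq> 0)"

text \<open>The standard Hermitian product on complex n-space, with a real second argument.\<close>

definition inner_cr :: "complex^'n \<Rightarrow> real^'n \<Rightarrow> complex" where
  "inner_cr z x = (\<Sum>i\<in>UNIV. z $ i * complex_of_real (x $ i))"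

definition infinitesimal_flex ::
    "'v set set \<Rightarrow> ('v \<Rightarrow> real^'n) \<Rightarrow> (real^'n \<Rightarrow> complex^'n) \<Rightarrow> bool" where
  "infinitesimal_flex E p u \<longleftrightarrow>
     (\<forall>v w. {v, w} \<in> E \<longrightarrow> inner_cr (u (p v) - u (p w)) (p v - p w) = 0)"

definition zero_mode_spectrum ::
    "'v set \<Rightarrow> 'v set set \<Rightarrow> ('v \<Rightarrow> real^'n) \<Rightarrow> ('n \<Rightarrow> real^'n) \<Rightarrow> (real^'n) set" where
  "zero_mode_spectrum V E p a =
     {\<gamma>. \<exists>u. infinitesimal_flex E p u \<and> nonzero_field V p u \<and>
        (\<forall>x\<in>joints V p. \<forall>k.
           u (transl a k x) =
             exp (2 * complex_of_real pi * \<i> *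
                  complex_of_real (\<Sum>i\<in>UNIV. of_int (k $ i) * \<gamma> $ i)) *s u x)}"

definition rational_line :: "(2 \<Rightarrow> real^2) \<Rightarrow> (real^2) set \<Rightarrow> bool" where
  "rational_line a H \<longleftrightarrow>
     (\<exists>j1 j2 :: int. (j1, j2) \<noteq> (0, 0) \<and>
        H = span {of_int j1 *\<^sub>R a 1 + of_int j2 *\<^sub>R a 2})"

definition reciprocal_line :: "(2 \<Rightarrow> real^2) \<Rightarrow> (real^2) set \<Rightarrow> (real^2) set \<Rightarrow> bool" where
  "reciprocal_line a H L \<longleftrightarrow>
     (\<exists>\<alpha> \<beta> :: real. (\<alpha>, \<beta>) \<noteq> (0, 0) \<and>
        H = span {\<alpha> *\<^sub>R a 1 + \<beta> *\<^sub>R a 2} \<and> L = span {vector [\<beta>, - \<alpha>]})"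

definition localised ::
    "'v set \<Rightarrow> ('v \<Rightarrow> real^'n) \<Rightarrow> (real^'n) set \<Rightarrow> (real^'n \<Rightarrow> complex^'n) \<Rightarrow> bool" where
  "localised V p H u \<longleftrightarrow> (\<exists>B. \<forall>x\<in>joints V p. u x \<noteq> 0 \<longrightarrow> infdist x H \<le> B)"

definition phase_periodic ::
    "'v set \<Rightarrow> ('v \<Rightarrow> real^2) \<Rightarrow> (2 \<Rightarrow> real^2) \<Rightarrow> (real^2) set \<Rightarrow> (real^2 \<Rightarrow> complex^2) \<Rightarrow> bool" where
  "phase_periodic V p a H u \<longleftrightarrow>
     (\<exists>(j1 :: int) (j2 :: int) h c.
        h = of_int j1 *\<^sub>R a 1 + of_int j2 *\<^sub>R a 2 \<and> h \<noteq> 0 \<and> H = span {h} \<and>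
        norm c = 1 \<and> (\<forall>x\<in>joints V p. u (x + h) = c *s u x))"

end

theory Submission imports Defs "HOL-Computational_Algebra.Polynomial" begin

text \<open>
  Let \<open>h = j\<^sub>1 a\<^sub>1 + j\<^sub>2 a\<^sub>2\<close> span \<open>H\<close> and put \<open>g = j\<^sub>2 a\<^sub>1 - j\<^sub>1 a\<^sub>2\<close>. Along a line parallel to the
  reciprocal line the phase \<open>c\<close> of a zero mode under translation by \<open>h\<close> is constant, while its
  phase \<open>z\<close> under translation by \<open>g\<close> runs through the whole unit circle. Modulo the sublattice
  generated by \<open>h\<close> and \<open>g\<close>, being a flex with phases \<open>c\<close> and \<open>z\<close> is a homogeneous linear
  system in finitely many unknowns whose coefficients are Laurent polynomials in \<open>z\<close>. As it
  has a nonzero solution for infinitely many \<open>z\<close>, it has a nonzero polynomial solution, and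
  the coefficients of that solution, spread along \<open>g\<close>, form an \<open>H\<close>-localised flex.
\<close>

section \<open>Polynomial linear systems\<close>

text \<open>Fraction-free Gaussian elimination of one unknown at a time.\<close>

lemma polynomial_kernel:
  fixes R :: "('c \<Rightarrow> 'a::idom poly) set"
  assumes "finite C" "infinite Z"
    and "\<And>z. z \<in> Z \<Longrightarrow> \<exists>v. (\<exists>c\<in>C. v c \<noteq> 0) \<and> (\<forall>r\<in>R. (\<Sum>c\<in>C. poly (r c) z * v c) = 0)"
  shows "\<exists>q. (\<exists>c\<in>C. q c \<noteq> 0) \<and> (\<forall>r\<in>R. (\<Sum>c\<in>C. r c * q c) = 0)"
  using assms
proof (induction C arbitrary: R Z rule: finite_induct)
  case empty
  then obtain z where "z \<in> Z" using infinite_imp_nonempty by blast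
  with empty show ?case by fastforce
next
  case (insert b C)
  show ?case
  proof (cases "\<forall>r\<in>R. r b = 0")
    case True
    \<comment> \<open>The unknown \<open>b\<close> occurs in no equation, so its indicator is a
      solution.\<close>
    define q :: "'c \<Rightarrow> 'a poly" where "q = (\<lambda>c. if c = b then 1 else 0)"
    have "(\<Sum>c\<in>insert b C. r c * q c) = 0" if "r \<in> R" for r
      using insert.hyps True that by (intro sum.neutral) (auto simp: q_def)
    moreover have "q b \<noteq> 0" by (simp add: q_def)
    ultimately show ?thesis by blast
  next
    case False
    then obtain r where r: "r \<in> R" "r b \<noteq> 0" by blast
    \<comment> \<open>Cross-multiplying with the pivot row \<open>r\<close> cancels the unknown
      \<open>b\<close> without leaving the polynomial ring.\<close>
    define R' where "R' = (\<lambda>s c. r b * s c - s b * r c) ` R"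
    \<comment> \<open>At a root of the pivot entry a solution could be supported on \<open>b\<close>
      alone. Only finitely many \<open>z\<close> are lost by avoiding this.\<close>
    define Z' where "Z' = Z - {z. poly (r b) z = 0}"
    have "infinite Z'"
      unfolding Z'_def using insert.prems(1) poly_roots_finite[OF r(2)] by simp
    moreover have "\<exists>v. (\<exists>c\<in>C. v c \<noteq> 0) \<and> (\<forall>s\<in>R'. (\<Sum>c\<in>C. poly (s c) z * v c) = 0)"
      if z: "z \<in> Z'" for z
    proof -
      from z have "z \<in> Z" and rb: "poly (r b) z \<noteq> 0" by (auto simp: Z'_def)
      from insert.prems(2)[OF this(1)] obtain v where v: "\<exists>c\<in>insert b C. v c \<noteq> 0"
        and eq: "\<And>s. s \<in> R \<Longrightarrow> poly (s b) z * v b + (\<Sum>c\<in>C. poly (s c) z * v c) = 0"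
        using insert.hyps by auto
      have "\<exists>c\<in>C. v c \<noteq> 0"
      proof (rule ccontr)
        assume *: "\<not> (\<exists>c\<in>C. v c \<noteq> 0)"
        then have "poly (r b) z * v b = 0" using eq[OF r(1)] by simp
        with * v rb show False by auto
      qed
      moreover have "(\<Sum>c\<in>C. poly (r b * s c - s b * r c) z * v c) = 0" if "s \<in> R" for s
      proof -
        have "(\<Sum>c\<in>C. poly (r b * s c - s b * r c) z * v c)
            = poly (r b) z * (\<Sum>c\<in>C. poly (s c) z * v c)
              - poly (s b) z * (\<Sum>c\<in>C. poly (r c) z * v c)"
          by (simp add: algebra_simps sum_subtractf sum_distrib_left)
        also have "(\<Sum>c\<in>C. poly (s c) z * v c) = - (poly (s b) z * v b)"
          using eq[OF that] by (simp add: add_eq_0_iff)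
        also have "(\<Sum>c\<in>C. poly (r c) z * v c) = - (poly (r b) z * v b)"
          using eq[OF r(1)] by (simp add: add_eq_0_iff)
        finally show ?thesis by (simp add: algebra_simps)
      qed
      ultimately show ?thesis unfolding R'_def by blast
    qed
    ultimately obtain w where w: "\<exists>c\<in>C. w c \<noteq> 0"
      and weq: "\<And>s. s \<in> R' \<Longrightarrow> (\<Sum>c\<in>C. s c * w c) = 0"
      using insert.IH[of Z' R'] by blast
    \<comment> \<open>Back substitution: scaling \<open>w\<close> by the pivot entry keeps the value
      at \<open>b\<close> that row \<open>r\<close> forces a polynomial.\<close>
    define q where "q = (\<lambda>c. if c = b then - (\<Sum>c\<in>C. r c * w c) else r b * w c)"
    have "(\<Sum>c\<in>insert b C. s c * q c) = 0" if "s \<in> R" for s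
    proof -
      have "(\<Sum>c\<in>C. s c * q c) = (\<Sum>c\<in>C. s c * (r b * w c))"
        using insert.hyps by (intro sum.cong) (auto simp: q_def)
      then have "(\<Sum>c\<in>insert b C. s c * q c)
          = s b * (- (\<Sum>c\<in>C. r c * w c)) + (\<Sum>c\<in>C. s c * (r b * w c))"
        using insert.hyps by (simp add: q_def)
      also have "\<dots> = (\<Sum>c\<in>C. (r b * s c - s b * r c) * w c)"
        by (simp add: algebra_simps sum_subtractf sum_distrib_left)
      also have "\<dots> = 0" using weq that unfolding R'_def by blast
      finally show ?thesis .
    qed
    moreover have "\<exists>c\<in>insert b C. q c \<noteq> 0"
      using w r insert.hyps by (auto simp: q_def)
    ultimately show ?thesis by blast
  qed
qed

section \<open>Flexes from a one-parameter family of zero modes\<close>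

text \<open>The last two assumptions make the decomposition unique, so \<open>h\<close> and
  \<open>g\<close> form a basis of the plane.\<close>

locale plane_coordinates =
  fixes h g :: "real^2" and A B :: "real^2 \<Rightarrow> real"
  assumes coords: "x = A x *\<^sub>R h + B x *\<^sub>R g"
    and A_comb [simp]: "A (s *\<^sub>R h + t *\<^sub>R g) = s"
    and B_comb [simp]: "B (s *\<^sub>R h + t *\<^sub>R g) = t"
begin

section \<open>Reduction to a fundamental cell of the lattice generated by \<open>h\<close> and
  \<open>g\<close>\<close>

lemma A_shift [simp]: "A (x + s *\<^sub>R h + t *\<^sub>R g) = A x + s"
  and B_shift [simp]: "B (x + s *\<^sub>R h + t *\<^sub>R g) = B x + t"
proof -
  have "x + s *\<^sub>R h + t *\<^sub>R g = (A x + s) *\<^sub>R h + (B x + t) *\<^sub>R g"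
    by (subst coords) (simp add: algebra_simps)
  then show "A (x + s *\<^sub>R h + t *\<^sub>R g) = A x + s" "B (x + s *\<^sub>R h + t *\<^sub>R g) = B x + t"
    by simp_all
qed

text \<open>The translate of \<open>x\<close> by this lattice that lies in \<open>cell\<close>, the
  half-open parallelogram spanned by \<open>h\<close> and \<open>g\<close>.\<close>

definition rep :: "real^2 \<Rightarrow> real^2" where
  "rep x = x + (- of_int \<lfloor>A x\<rfloor>) *\<^sub>R h + (- of_int \<lfloor>B x\<rfloor>) *\<^sub>R g"

definition cell :: "(real^2) set" where
  "cell = {x. \<lfloor>A x\<rfloor> = 0 \<and> \<lfloor>B x\<rfloor> = 0}"

lemma rep_in_cell: "rep x \<in> cell"
  unfolding cell_def rep_def mem_Collect_eq A_shift B_shift by (simp add: floor_eq_iff)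

lemma rep_cell: "x \<in> cell \<Longrightarrow> rep x = x"
  by (simp add: cell_def rep_def)

lemma rep_decomp: "x = rep x + of_int \<lfloor>A x\<rfloor> *\<^sub>R h + of_int \<lfloor>B x\<rfloor> *\<^sub>R g"
  by (simp add: rep_def)

lemma rep_shift: "rep (x + of_int r *\<^sub>R h + of_int s *\<^sub>R g) = rep x"
  unfolding rep_def A_shift B_shift by (simp add: algebra_simps)

text \<open>Compare \<open>x\<close> with its projection to the line along \<open>g\<close>.
  Localisation thus reduces to a bound for \<open>B\<close> on the support.\<close>

lemma infdist_span_le: "infdist x (span {h}) \<le> \<bar>B x\<bar> * norm g"
proof -
  have "infdist x (span {h}) \<le> dist x (A x *\<^sub>R h)"
    by (intro infdist_le) (simp add: span_base span_scale)
  also have "\<dots> = norm (B x *\<^sub>R g)"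
    by (subst (1) coords) (simp add: dist_norm)
  finally show ?thesis by simp
qed

text \<open>A mode is determined by its values on the finitely many joints in \<open>cell\<close>. A
  polynomial solution \<open>q\<close> of the bar equations satisfies them in every degree of
  \<open>z\<close>, and multiplication by \<open>z\<close> corresponds to a shift along
  \<open>g\<close>. Placing the coefficient of degree \<open>m\<close> in layer \<open>-m\<close>
  therefore gives a flex, and finite degree bounds its support.\<close>

lemma localised_flex:
  assumes graph: "simple_graph V E"
    and inv: "\<And>x r s. x \<in> joints V p \<Longrightarrow> x + of_int r *\<^sub>R h + of_int s *\<^sub>R g \<in> joints V p"
    and fin: "finite (joints V p \<inter> cell)"
    and "infinite Z" "0 \<notin> Z" "c \<noteq> 0"
    and modes: "\<And>z. z \<in> Z \<Longrightarrow> \<exists>u. infinitesimal_flex E p u \<and> nonzero_field V p u \<and>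
      (\<forall>x\<in>joints V p. \<forall>r s.
         u (x + of_int r *\<^sub>R h + of_int s *\<^sub>R g) = (c powi r * z powi s) *s u x)"
  shows "\<exists>u. infinitesimal_flex E p u \<and> nonzero_field V p u \<and> localised V p (span {h}) u \<and>
      (\<forall>x. u (x + h) = c *s u x)"
proof -
  let ?J = "joints V p"
  let ?F = "?J \<inter> cell"
  have rep_F: "rep x \<in> ?F" if "x \<in> ?J" for x
    using inv[OF that, of "- \<lfloor>A x\<rfloor>" "- \<lfloor>B x\<rfloor>"] rep_in_cell by (simp add: rep_def)
  have ends: "p v \<in> ?J \<and> p w \<in> ?J" if "{v, w} \<in> E" for v w
    using graph that unfolding simple_graph_def joints_def by (metis doubleton_eq_iff imageI)
  \<comment> \<open>\<open>row x y\<close> is the bar equation multiplied by the power of \<open>z\<close> that clears negative exponents.\<close>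
  define lo where "lo x y = min \<lfloor>B x\<rfloor> \<lfloor>B y\<rfloor>" for x y :: "real^2"
  define tm where "tm x l = monom (c powi \<lfloor>A x\<rfloor>) (nat (\<lfloor>B x\<rfloor> - l))" for x :: "real^2" and l
  define row where "row x y = (\<lambda>(f, i). smult (of_real ((x - y) $ i))
      ((if f = rep x then tm x (lo x y) else 0) - (if f = rep y then tm y (lo x y) else 0)))"
    for x y :: "real^2"
  define R where "R = {row (p v) (p w) |v w. {v, w} \<in> E}"
  let ?C = "?F \<times> (UNIV :: 2 set)"

  \<comment> \<open>Only the columns of the two representatives contribute; both terms survive even
    if these coincide.\<close>
  have row_sum: "(\<Sum>k\<in>?C. poly (row x y k) z * v k)
      = (\<Sum>i\<in>UNIV. of_real ((x - y) $ i) *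
          (poly (tm x (lo x y)) z * v (rep x, i) - poly (tm y (lo x y)) z * v (rep y, i)))"
    if "x \<in> ?J" "y \<in> ?J" for x y z v
  proof -
    have "(\<Sum>k\<in>?C. poly (row x y k) z * v k)
        = (\<Sum>i\<in>UNIV. \<Sum>f\<in>?F. of_real ((x - y) $ i) *
            ((if f = rep x then poly (tm x (lo x y)) z * v (f, i) else 0)
              - (if f = rep y then poly (tm y (lo x y)) z * v (f, i) else 0)))"
      unfolding sum.cartesian_product'
      by (subst sum.swap) (intro sum.cong, auto simp: row_def algebra_simps)
    then show ?thesis
      using rep_F[OF that(1)] rep_F[OF that(2)] fin
      by (simp flip: sum_distrib_left add: sum_subtractf)
  qed
  have row_sum': "(\<Sum>k\<in>?C. row x y k * q k)
      = (\<Sum>i\<in>UNIV. smult (of_real ((x - y) $ i))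
          (tm x (lo x y) * q (rep x, i) - tm y (lo x y) * q (rep y, i)))"
    if "x \<in> ?J" "y \<in> ?J" for x y q
  \<comment> \<open>A complex polynomial is determined by its values, so the numerical identity
    suffices.\<close>
  proof (rule poly_ext)
    fix z
    show "poly (\<Sum>k\<in>?C. row x y k * q k) z
      = poly (\<Sum>i\<in>UNIV. smult (of_real ((x - y) $ i))
          (tm x (lo x y) * q (rep x, i) - tm y (lo x y) * q (rep y, i))) z"
      using row_sum[OF that, of z "\<lambda>k. poly (q k) z"] by (simp add: poly_sum)
  qed

  have "\<exists>v. (\<exists>k\<in>?C. v k \<noteq> 0) \<and> (\<forall>r\<in>R. (\<Sum>k\<in>?C. poly (r k) z * v k) = 0)" if z: "z \<in> Z" for z
  proof -
    from modes[OF z] obtain u where flex: "infinitesimal_flex E p u" and nz: "nonzero_field V p u"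
      and per: "\<And>x r s. x \<in> ?J \<Longrightarrow>
        u (x + of_int r *\<^sub>R h + of_int s *\<^sub>R g) = (c powi r * z powi s) *s u x"
      by blast
    have "z \<noteq> 0" using z \<open>0 \<notin> Z\<close> by auto
    have u_rep: "u x = (c powi \<lfloor>A x\<rfloor> * z powi \<lfloor>B x\<rfloor>) *s u (rep x)" if "x \<in> ?J" for x
      using per[of "rep x" "\<lfloor>A x\<rfloor>" "\<lfloor>B x\<rfloor>"] rep_F[OF that] rep_decomp[of x] by simp
    \<comment> \<open>The candidate solution is the mode restricted to the cell. It is nonzero
      there, since each value of \<open>u\<close> at a joint is a multiple of the value at the
      representative.\<close>
    define v where "v = (\<lambda>(f, i). u f $ i)"
    obtain x where x: "x \<in> ?J" "u x \<noteq> 0" using nz unfolding nonzero_field_def by blast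
    then have "u (rep x) \<noteq> 0" using u_rep[of x] by auto
    then obtain i where "u (rep x) $ i \<noteq> 0" by (auto simp: vec_eq_iff)
    then have "v (rep x, i) \<noteq> 0" "(rep x, i) \<in> ?C" using rep_F[OF x(1)] by (auto simp: v_def)
    moreover have "(\<Sum>k\<in>?C. poly (row x y k) z * v k) = 0"
      if xy: "x \<in> ?J" "y \<in> ?J" and eq: "inner_cr (u x - u y) (x - y) = 0" for x y
    proof -
      \<comment> \<open>Both ends acquire the same factor, so the row is a multiple of the bar
        equation.\<close>
      have tm: "poly (tm t (lo x y)) z * v (rep t, i) = z powi (- lo x y) * u t $ i"
        if "t = x \<or> t = y" for t i
      proof -
        have "t \<in> ?J" "\<lfloor>B t\<rfloor> \<ge> lo x y" using that xy by (auto simp: lo_def)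
        then have "poly (tm t (lo x y)) z = c powi \<lfloor>A t\<rfloor> * z powi (\<lfloor>B t\<rfloor> - lo x y)"
          by (simp add: tm_def poly_monom power_int_def)
        also have "\<dots> = z powi (- lo x y) * (c powi \<lfloor>A t\<rfloor> * z powi \<lfloor>B t\<rfloor>)"
          using \<open>z \<noteq> 0\<close> by (simp add: power_int_diff power_int_minus field_simps)
        finally show ?thesis
          by (subst u_rep[OF \<open>t \<in> ?J\<close>]) (simp add: v_def)
      qed
      have "(\<Sum>k\<in>?C. poly (row x y k) z * v k)
          = z powi (- lo x y) * inner_cr (u x - u y) (x - y)"
        unfolding row_sum[OF xy] inner_cr_def sum_distrib_left
        by (intro sum.cong) (simp_all add: tm algebra_simps)
      with eq show ?thesis by simp
    qed
    then have "\<forall>r\<in>R. (\<Sum>k\<in>?C. poly (r k) z * v k) = 0"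
      using flex ends unfolding R_def infinitesimal_flex_def by blast
    ultimately show ?thesis by blast
  qed
  from polynomial_kernel[OF _ \<open>infinite Z\<close> this] fin obtain q
    where q0: "\<exists>k\<in>?C. q k \<noteq> 0" and q: "\<And>r. r \<in> R \<Longrightarrow> (\<Sum>k\<in>?C. r k * q k) = 0"
    by auto

  \<comment> \<open>\<open>cf\<close> extends coefficients by zero to negative degrees. Formally,
    \<open>u x\<close> is the coefficient of degree zero in \<open>c powi \<lfloor>A x\<rfloor> * z
    powi \<lfloor>B x\<rfloor> * q (rep x, i)\<close>, hence the minus sign.\<close>
  define cf where "cf P m = (if m < 0 then 0 else coeff P (nat m))" for P :: "complex poly" and m :: int
  define u :: "real^2 \<Rightarrow> complex^2"
    where "u x = (\<chi> i. c powi \<lfloor>A x\<rfloor> * cf (q (rep x, i)) (- \<lfloor>B x\<rfloor>))" for x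
  \<comment> \<open>The monomial shifts degrees by \<open>\<lfloor>B x\<rfloor> - l\<close>. For
    positive \<open>l\<close> both sides vanish by the convention for negative degrees.\<close>
  have coeff_tm: "cf (tm x l * q (rep x, i)) (- l) = u x $ i" if "l \<le> \<lfloor>B x\<rfloor>" for x l i
  proof (cases "l \<le> 0")
    case True
    with that have "nat (\<lfloor>B x\<rfloor> - l) \<le> nat (- l) \<longleftrightarrow> \<lfloor>B x\<rfloor> \<le> 0"
      and "\<lfloor>B x\<rfloor> \<le> 0 \<Longrightarrow> nat (- l) - nat (\<lfloor>B x\<rfloor> - l) = nat (- \<lfloor>B x\<rfloor>)"
      by linarith+
    with True show ?thesis
      by (simp add: tm_def cf_def u_def coeff_monom_mult del: nat_le_iff nat_le_eq_zle zero_less_floor floor_le_zero)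
  next
    case False
    with that have "0 < \<lfloor>B x\<rfloor>" by linarith
    with False show ?thesis by (simp add: cf_def u_def)
  qed
  have "inner_cr (u x - u y) (x - y) = 0"
    if xy: "x \<in> ?J" "y \<in> ?J" and eq: "(\<Sum>k\<in>?C. row x y k * q k) = 0" for x y
  proof -
    have cf_lin: "cf (\<Sum>i\<in>UNIV. smult (d i) (P i - Q i)) m = (\<Sum>i\<in>UNIV. d i * (cf (P i) m - cf (Q i) m))"
      for d :: "2 \<Rightarrow> complex" and P Q m by (simp add: cf_def coeff_sum)
    have lo: "lo x y \<le> \<lfloor>B x\<rfloor>" "lo x y \<le> \<lfloor>B y\<rfloor>" by (auto simp: lo_def)
    \<comment> \<open>Clearing exponents moved degree zero to \<open>- lo x y\<close>, so that
      coefficient of the row is the bar equation for \<open>u\<close>.\<close>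
    have "inner_cr (u x - u y) (x - y) = cf (\<Sum>k\<in>?C. row x y k * q k) (- lo x y)"
      unfolding row_sum'[OF xy] cf_lin inner_cr_def
      by (intro sum.cong) (simp_all add: coeff_tm lo)
    with eq show ?thesis by (simp add: cf_def)
  qed
  then have "infinitesimal_flex E p u"
    using q ends unfolding infinitesimal_flex_def R_def by blast
  moreover have "nonzero_field V p u"
  proof -
    obtain f i where f: "f \<in> ?F" "q (f, i) \<noteq> 0" using q0 by auto
    then obtain m where m: "coeff (q (f, i)) m \<noteq> 0" by (metis leading_coeff_0_iff)
    \<comment> \<open>The translate of \<open>f\<close> in layer \<open>-m\<close>, where the
      nonzero coefficient of degree \<open>m\<close> was placed.\<close>
    let ?x = "f + of_int 0 *\<^sub>R h + of_int (- int m) *\<^sub>R g"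
    have "rep ?x = f" using rep_shift[of f 0 "- int m"] rep_cell f(1) by auto
    moreover have "\<lfloor>A ?x\<rfloor> = 0" "\<lfloor>B ?x\<rfloor> = - int m"
      unfolding A_shift B_shift using f(1) by (auto simp: cell_def floor_eq_iff)
    ultimately have "u ?x $ i \<noteq> 0" using m by (simp add: u_def cf_def)
    moreover have "?x \<in> ?J" by (intro inv) (use f in auto)
    ultimately show ?thesis unfolding nonzero_field_def by (metis zero_index)
  qed
  moreover have "localised V p (span {h}) u"
  proof -
    define D where "D = Max ((\<lambda>k. degree (q k)) ` ?C)"
    have "infdist x (span {h}) \<le> (real D + 1) * norm g" if x: "x \<in> ?J" "u x \<noteq> 0" for x
    proof -
      obtain i where "u x $ i \<noteq> 0" using x(2) by (auto simp: vec_eq_iff)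
      then have c0: "\<lfloor>B x\<rfloor> \<le> 0" and "coeff (q (rep x, i)) (nat (- \<lfloor>B x\<rfloor>)) \<noteq> 0"
        by (auto simp: u_def cf_def split: if_splits)
      from this(2) have "nat (- \<lfloor>B x\<rfloor>) \<le> degree (q (rep x, i))" by (rule le_degree)
      also have "\<dots> \<le> D"
        unfolding D_def using rep_F[OF x(1)] fin by (intro Max_ge) auto
      finally have "- \<lfloor>B x\<rfloor> \<le> int D" by simp
      \<comment> \<open>The floor lies between \<open>-D\<close> and 0, so \<open>B x\<close> itself
        may still be positive but is below 1.\<close>
      then have "\<bar>B x\<bar> \<le> real D + 1" using c0 by linarith
      then show ?thesis
        using infdist_span_le[of x] by (meson mult_right_mono norm_ge_zero order_trans)
    qed
    then show ?thesis unfolding localised_def by blast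
  qed
  moreover have "u (x + h) = c *s u x" for x
  proof -
    have "rep (x + h) = rep x" using rep_shift[of x 1 0] by simp
    moreover have "A (x + h) = A x + 1" "B (x + h) = B x"
      using A_shift[of x 1 0] B_shift[of x 1 0] by simp_all
    ultimately show ?thesis
      unfolding u_def using \<open>c \<noteq> 0\<close>
      by (intro vec_eq_iff[THEN iffD2]) (simp add: power_int_add)
  qed
  ultimately show ?thesis by blast
qed

end

section \<open>Crystal frameworks in the plane\<close>

lemma transl_2: "transl a k x = x + of_int (k $ 1) *\<^sub>R a 1 + of_int (k $ 2) *\<^sub>R a (2::2)"
  by (simp add: transl_def sum_2 add.assoc)

lemma is_basis_2_unique:
  fixes a :: "2 \<Rightarrow> real^2"
  assumes "is_basis a" "s *\<^sub>R a 1 + t *\<^sub>R a 2 = s' *\<^sub>R a 1 + t' *\<^sub>R a 2"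
  shows "s = s' \<and> t = t'"
proof -
  have ind: "independent {a 1, a 2}" and ne: "a 1 \<noteq> a 2"
    using assms(1) unfolding is_basis_def by (auto simp: UNIV_2 inj_def)
  define f where "f = (\<lambda>x. if x = a 1 then s - s' else t - t')"
  have "(\<Sum>x\<in>{a 1, a 2}. f x *\<^sub>R x) = 0"
    using ne assms(2) by (simp add: f_def algebra_simps)
  from independentD[OF ind _ subset_refl this] have "f (a 1) = 0" "f (a 2) = 0" by auto
  then show ?thesis using ne by (auto simp: f_def)
qed

lemma is_basis_2_span:
  fixes a :: "2 \<Rightarrow> real^2"
  assumes "is_basis a"
  shows "\<exists>s t. x = s *\<^sub>R a 1 + t *\<^sub>R a 2"
proof -
  have "x \<in> span {a 1, a 2}" using assms unfolding is_basis_def by (auto simp: UNIV_2)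
  then obtain s t where "x - s *\<^sub>R a 1 - t *\<^sub>R a 2 = 0"
    unfolding span_insert by auto
  then have "x = s *\<^sub>R a 1 + t *\<^sub>R a 2" by (simp add: algebra_simps)
  then show ?thesis by blast
qed

text \<open>The joint set equals its translate by \<open>a i\<close>, so \<open>a i\<close> may also
  be subtracted and negative multiples are reached.\<close>

lemma crystal_joints_transl:
  fixes p :: "'v \<Rightarrow> real^2"
  assumes "crystal_framework V E p a" "x \<in> joints V p"
  shows "x + of_int m *\<^sub>R a 1 + of_int n *\<^sub>R a 2 \<in> joints V p"
proof -
  have step: "y + of_int m *\<^sub>R a i \<in> joints V p" if "y \<in> joints V p" for y m i
  proof -
    have im: "(\<lambda>x. x + a i) ` joints V p = joints V p"
      using assms(1) by (simp add: crystal_framework_def)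
    have up: "y + a i \<in> joints V p" if "y \<in> joints V p" for y
      using im imageI[OF that, of "\<lambda>x. x + a i"] by simp
    have down: "y - a i \<in> joints V p" if "y \<in> joints V p" for y
    proof -
      from that have "y \<in> (\<lambda>x. x + a i) ` joints V p" using im by simp
      then obtain w where "w \<in> joints V p" "y = w + a i" by (rule imageE)
      then show ?thesis by simp
    qed
    show ?thesis
    proof (induction m rule: int_induct[where k = 0])
      case base
      show ?case using that by simp
    next
      case (step1 m)
      then show ?case using up[OF step1(2)] by (simp add: algebra_simps)
    next
      case (step2 m)
      then show ?case using down[OF step2(2)] by (simp add: algebra_simps)
    qed
  qed
  show ?thesis using step[OF step[OF assms(2)]] .
qed

lemma finite_int_vec_box: "finite {k :: int^2. \<bar>k $ 1\<bar> \<le> N \<and> \<bar>k $ 2\<bar> \<le> N}"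
proof (rule finite_subset)
  show "{k :: int^2. \<bar>k $ 1\<bar> \<le> N \<and> \<bar>k $ 2\<bar> \<le> N}
      \<subseteq> (\<lambda>(m, n). vector [m, n]) ` ({-N..N} \<times> {-N..N})"
  proof
    fix k :: "int^2"
    assume "k \<in> {k. \<bar>k $ 1\<bar> \<le> N \<and> \<bar>k $ 2\<bar> \<le> N}"
    moreover have "k = vector [k $ 1, k $ 2]" by (simp add: vec_eq_iff forall_2)
    ultimately show "k \<in> (\<lambda>(m, n). vector [m, n]) ` ({-N..N} \<times> {-N..N})"
      by (intro image_eqI[of _ _ "(k $ 1, k $ 2)"]) auto
  qed
qed simp

theorem theorem2p8:
  fixes V :: "'v set" and E :: "'v set set" and p :: "'v \<Rightarrow> real^2"
    and a :: "2 \<Rightarrow> real^2" and H L :: "(real^2) set"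
  assumes "crystal_framework V E p a"
    and "rational_line a H"
    and "reciprocal_line a H L"
    and "\<exists>\<gamma>\<^sub>0. (\<lambda>x. \<gamma>\<^sub>0 + x) ` L \<subseteq> zero_mode_spectrum V E p a"
  shows "\<exists>u :: real^2 \<Rightarrow> complex^2.
           infinitesimal_flex E p u \<and> nonzero_field V p u \<and>
           localised V p H u \<and> phase_periodic V p a H u"
proof -
  let ?J = "joints V p"
  have basis: "is_basis a" and graph: "simple_graph V E"
    and orbits: "finite ((\<lambda>x. {transl a k x |k. True}) ` ?J)"
    using assms(1) unfolding crystal_framework_def bar_joint_framework_def by blast+
  obtain j1 j2 :: int where j: "(j1, j2) \<noteq> (0, 0)"
    and H: "H = span {of_int j1 *\<^sub>R a 1 + of_int j2 *\<^sub>R a 2}"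
    using assms(2) unfolding rational_line_def by blast
  define h where "h = of_int j1 *\<^sub>R a 1 + of_int j2 *\<^sub>R a 2"
  \<comment> \<open>The coordinates of \<open>g\<close> are those of the reciprocal direction
    \<open>(j2, -j1)\<close>. Pairing with this direction gives 0 for \<open>h\<close> and
    \<open>N\<close> for \<open>g\<close>.\<close>
  define g where "g = of_int j2 *\<^sub>R a 1 - of_int j1 *\<^sub>R a 2"
  define N :: real where "N = of_int j1 ^ 2 + of_int j2 ^ 2"
  have "N > 0" using j by (auto simp: N_def sum_power2_gt_zero_iff)

  obtain \<alpha> \<beta> where L: "H = span {\<alpha> *\<^sub>R a 1 + \<beta> *\<^sub>R a 2}" "L = span {vector [\<beta>, - \<alpha>]}"
    using assms(3) unfolding reciprocal_line_def by blast
  \<comment> \<open>\<open>L\<close> is given by some real generator of \<open>H\<close>; comparing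
    it with \<open>h\<close> shows that the integer direction \<open>(j2, -j1)\<close> lies in
    \<open>L\<close>.\<close>
  have "h \<in> span {\<alpha> *\<^sub>R a 1 + \<beta> *\<^sub>R a 2}" using L(1) H by (metis h_def insertI1 span_base)
  then obtain \<kappa> where "h = \<kappa> *\<^sub>R (\<alpha> *\<^sub>R a 1 + \<beta> *\<^sub>R a 2)" by (auto simp: span_singleton)
  then have "of_int j1 = \<kappa> * \<alpha> \<and> of_int j2 = \<kappa> * \<beta>"
    by (intro is_basis_2_unique[OF basis]) (simp add: h_def algebra_simps)
  then have jL: "t *\<^sub>R vector [of_int j2, - of_int j1] \<in> L" for t
    by (auto simp: L(2) span_singleton vec_eq_iff forall_2 intro!: image_eqI[of _ _ "t * \<kappa>"])
  obtain \<gamma> where "(\<lambda>x. \<gamma> + x) ` L \<subseteq> zero_mode_spectrum V E p a" using assms(4) by blast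
  with jL have line: "\<gamma> + t *\<^sub>R vector [of_int j2, - of_int j1] \<in> zero_mode_spectrum V E p a" for t
    by blast

  have comb: "s *\<^sub>R h + t *\<^sub>R g
      = (s * of_int j1 + t * of_int j2) *\<^sub>R a 1 + (s * of_int j2 - t * of_int j1) *\<^sub>R a 2" for s t
    by (simp add: h_def g_def algebra_simps)
  have "\<exists>s t. x = s *\<^sub>R h + t *\<^sub>R g" for x
  proof -
    obtain c d where x: "x = c *\<^sub>R a 1 + d *\<^sub>R a 2" using is_basis_2_span[OF basis] by blast
    \<comment> \<open>The matrix with rows \<open>(j1, j2)\<close> and \<open>(j2, -j1)\<close>
      squares to \<open>N\<close> times the identity, so its inverse is itself divided by
      \<open>N\<close>.\<close>
    let ?s = "(c * of_int j1 + d * of_int j2) / N" and ?t = "(c * of_int j2 - d * of_int j1) / N"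
    have "N * (?s * of_int j1 + ?t * of_int j2) = N * c" "N * (?s * of_int j2 - ?t * of_int j1) = N * d"
      using \<open>N > 0\<close> by (simp_all add: distrib_left right_diff_distrib)
        (simp_all add: N_def algebra_simps power2_eq_square)
    then have "?s * of_int j1 + ?t * of_int j2 = c" "?s * of_int j2 - ?t * of_int j1 = d"
      using \<open>N > 0\<close> by simp_all
    then have "x = ?s *\<^sub>R h + ?t *\<^sub>R g" unfolding comb x by simp
    then show ?thesis by blast
  qed
  then obtain A B where AB: "\<And>x. x = A x *\<^sub>R h + B x *\<^sub>R g" by metis
  have uniq: "s = s' \<and> t = t'" if "s *\<^sub>R h + t *\<^sub>R g = s' *\<^sub>R h + t' *\<^sub>R g" for s t s' t'
  proof -
    have e: "(s - s') * of_int j1 + (t - t') * of_int j2 = 0" (is "?x = 0")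
      "(s - s') * of_int j2 - (t - t') * of_int j1 = 0" (is "?y = 0")
      using is_basis_2_unique[OF basis that[unfolded comb]] by (simp_all add: algebra_simps)
    have "N * (s - s') = ?x * of_int j1 + ?y * of_int j2" "N * (t - t') = ?x * of_int j2 - ?y * of_int j1"
      by (simp_all add: N_def algebra_simps power2_eq_square)
    then show ?thesis using \<open>N > 0\<close> unfolding e by simp
  qed
  interpret plane_coordinates h g A B
    using AB uniq by unfold_locales metis+

  have lat: "x + of_int r *\<^sub>R h + of_int s *\<^sub>R g
      = transl a (vector [r * j1 + s * j2, r * j2 - s * j1]) x" for x r s
    by (simp add: transl_2 h_def g_def algebra_simps)
  have inv: "x + of_int r *\<^sub>R h + of_int s *\<^sub>R g \<in> ?J" if "x \<in> ?J" for x r s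
    unfolding lat transl_2 by (rule crystal_joints_transl[OF assms(1) that])

  have "finite (?J \<inter> cell)"
  proof -
    \<comment> \<open>Orbits refer to the full lattice, the cell to a sublattice, so an orbit may
      meet the cell repeatedly. Entering the cell bounds the shifts in \<open>A\<close> and
      \<open>B\<close>, hence the integer coordinates \<open>k\<close>.\<close>
    have orbit_cell: "finite ({transl a k x |k. True} \<inter> cell)" for x
    proof -
      define M where "M = (\<bar>A x\<bar> + \<bar>B x\<bar> + 2) * (\<bar>of_int j1\<bar> + \<bar>of_int j2\<bar>)"
      have "\<bar>k $ 1\<bar> \<le> \<lceil>M\<rceil> \<and> \<bar>k $ 2\<bar> \<le> \<lceil>M\<rceil>" if k: "transl a k x \<in> cell" for k
      proof -
        let ?y = "of_int (k $ 1) *\<^sub>R a 1 + of_int (k $ 2) *\<^sub>R a 2"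
        define s t where "s = A ?y" and "t = B ?y"
        have y: "?y = s *\<^sub>R h + t *\<^sub>R g" unfolding s_def t_def by (rule coords)
        have "transl a k x = x + s *\<^sub>R h + t *\<^sub>R g"
          using y by (simp add: transl_2 add.assoc)
        with k have "\<lfloor>A x + s\<rfloor> = 0" "\<lfloor>B x + t\<rfloor> = 0" by (auto simp: cell_def)
        then have st: "\<bar>s\<bar> \<le> \<bar>A x\<bar> + 1" "\<bar>t\<bar> \<le> \<bar>B x\<bar> + 1" by linarith+
        have bound: "\<bar>s * b\<bar> + \<bar>t * d\<bar> \<le> (\<bar>A x\<bar> + \<bar>B x\<bar> + 2) * (\<bar>b\<bar> + \<bar>d\<bar>)" for b d :: real
          unfolding abs_mult distrib_left using st
          by (intro add_mono mult_right_mono) auto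
        have "real_of_int (k $ 1) = s * of_int j1 + t * of_int j2 \<and>
            real_of_int (k $ 2) = s * of_int j2 - t * of_int j1"
          using y unfolding comb by (rule is_basis_2_unique[OF basis])
        then have "\<bar>real_of_int (k $ 1)\<bar> \<le> M \<and> \<bar>real_of_int (k $ 2)\<bar> \<le> M"
          using bound[of "of_int j1" "of_int j2"] bound[of "of_int j2" "of_int j1"]
          unfolding M_def add.commute[of "\<bar>real_of_int j2\<bar>"] by linarith
        then show ?thesis by linarith
      qed
      then have "{transl a k x |k. True} \<inter> cell
          \<subseteq> (\<lambda>k. transl a k x) ` {k. \<bar>k $ 1\<bar> \<le> \<lceil>M\<rceil> \<and> \<bar>k $ 2\<bar> \<le> \<lceil>M\<rceil>}"
        by blast
      then show ?thesis by (rule finite_subset) (intro finite_imageI finite_int_vec_box)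
    qed
    have "x \<in> {transl a k x |k. True}" for x
      by (auto simp: transl_2 intro!: exI[of _ 0])
    then have "?J \<inter> cell \<subseteq> (\<Union>S\<in>(\<lambda>x. {transl a k x |k. True}) ` ?J. S \<inter> cell)" by blast
    moreover have "finite (\<Union>S\<in>(\<lambda>x. {transl a k x |k. True}) ` ?J. S \<inter> cell)"
      using orbits orbit_cell by (intro finite_UN_I) auto
    ultimately show ?thesis by (rule finite_subset)
  qed
  moreover
  \<comment> \<open>The phases under translation by \<open>h\<close> and \<open>g\<close> at
    parameter \<open>t\<close> of the line: \<open>t\<close> cancels for \<open>h\<close> and
    contributes \<open>t * N\<close> for \<open>g\<close>.\<close>
  define c where "c = cis (2 * pi * (\<gamma> $ 1 * of_int j1 + \<gamma> $ 2 * of_int j2))"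
  define \<zeta> where "\<zeta> t = cis (2 * pi * (\<gamma> $ 1 * of_int j2 - \<gamma> $ 2 * of_int j1 + t * N))" for t
  have "infinite (range \<zeta>)"
  proof -
    \<comment> \<open>As \<open>N > 0\<close>, the argument of \<open>\<zeta>\<close> takes every
      real value. The half circle, where the cosine is injective, already has infinitely many
      points.\<close>
    have "cis \<theta> \<in> range \<zeta>" for \<theta>
      by (rule range_eqI[of _ _ "(\<theta> / (2 * pi) - (\<gamma> $ 1 * of_int j2 - \<gamma> $ 2 * of_int j1)) / N"])
        (use \<open>N > 0\<close> in \<open>simp add: \<zeta>_def field_simps\<close>)
    then have "cis ` {0..pi} \<subseteq> range \<zeta>" by blast
    moreover have "inj_on cis {0..pi}"
      by (rule inj_onI) (auto simp: complex_eq_iff intro: cos_inj_pi)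
    then have "infinite (cis ` {0..pi})" by (simp add: finite_image_iff infinite_Icc)
    ultimately show ?thesis using finite_subset by blast
  qed
  moreover have "0 \<notin> range \<zeta>" "c \<noteq> 0" by (auto simp: \<zeta>_def c_def)
  moreover have "\<exists>u. infinitesimal_flex E p u \<and> nonzero_field V p u \<and>
      (\<forall>x\<in>?J. \<forall>r s. u (x + of_int r *\<^sub>R h + of_int s *\<^sub>R g) = (c powi r * z powi s) *s u x)"
    if z_in: "z \<in> range \<zeta>" for z
  proof -
    obtain t where z: "z = \<zeta> t" using z_in by blast
    obtain u where u: "infinitesimal_flex E p u" "nonzero_field V p u"
      and per: "\<And>x k. x \<in> ?J \<Longrightarrow> u (transl a k x) = exp (2 * complex_of_real pi * \<i> *
        complex_of_real (\<Sum>i\<in>UNIV. of_int (k $ i) *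
          (\<gamma> + t *\<^sub>R vector [of_int j2, - of_int j1]) $ i)) *s u x"
      using line[of t] unfolding zero_mode_spectrum_def by blast
    have phase: "exp (2 * complex_of_real pi * \<i> * complex_of_real (\<Sum>i\<in>UNIV.
          of_int ((vector [r * j1 + s * j2, r * j2 - s * j1] :: int^2) $ i) *
          (\<gamma> + t *\<^sub>R vector [of_int j2, - of_int j1]) $ i)) = c powi r * z powi s" for r s
      unfolding c_def z \<zeta>_def cis_power_int cis_mult unfolding cis_conv_exp
      by (rule arg_cong[where f = exp]) (simp add: sum_2 N_def algebra_simps power2_eq_square)
    have "u (x + of_int r *\<^sub>R h + of_int s *\<^sub>R g) = (c powi r * z powi s) *s u x"
      if "x \<in> ?J" for x r s
      unfolding lat per[OF that] phase ..
    with u show ?thesis by blast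
  qed
  ultimately obtain u where u: "infinitesimal_flex E p u" "nonzero_field V p u"
      "localised V p (span {h}) u" "\<forall>x. u (x + h) = c *s u x"
    using localised_flex[OF graph inv, of "range \<zeta>" c] by blast
  have "h \<noteq> 0" using uniq[of 1 0 0 0] by auto
  moreover have "norm c = 1" by (simp add: c_def)
  ultimately have "phase_periodic V p a H u"
    unfolding phase_periodic_def using u(4) H h_def by blast
  then show ?thesis using u H h_def by auto
qed

end
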